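(* Let $X_n$ denote the number of returns to zero of a (random weighted) Motzkin walk of length $n$. Let $\delta=P'(1)$ be the drift. 1. If $\delta\neq 0$, then $X_n$ converges in distribution to a geometric distribution: $$X_n\stackrel{d}{\to}\operatorname{Geom}\left(\frac{|p_1-p_{-1}|}{P(1)}\right).$$ 2. If $\delta=0$, then the normalized random variable converges to a half-normal distribution: $$\frac{X_n}{\sqrt n}\stackrel{d}{\to}\mathcal{H}\left(\sqrt{\frac{P(1)}{P''(1)}}\right).$$
   Context: A Motzkin walk of length $n$ is a sequence of altitudes $\omega=(\omega_0,\dots,\omega_n)$ with $\omega_0=0$ and $\omega_i-\omega_{i-1}\in\{-1,0,1\}$ (no positivity constraint). The steps $-1,0,1$ carry weights $p_{-1},p_0,p_1>0$; the weight of a walk is the product of the weights of its steps. The jump polynomial is $P(u)=p_{-1}u^{-1}+p_0+p_1u$. A random walk of length $n$ is drawn among all walks of length $n$ with probability proportional to its weight (the total weight is $P(1)^n$); so $\mathbb{P}[X_n=k]$ is the total weight of walks of length $n$ with parameter value $k$ divided by $P(1)^n$. A return to zero is a point $\omega_i=0$ of the walk with $i\ge 1$ (i.e. a point of altitude $0$, except for the starting point). $\operatorname{Geom}(p)$ is the distribution on $\{0,1,2,\dots\}$ with probabilities $(1-p)^kp$. $\mathcal{H}(\sigma)$ is the half-normal distribution with density $\sqrt{\frac{2}{\pi\sigma^2}}\exp\left(-\frac{x^2}{2\sigma^2}\right)$ on $x\ge 0$. *)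

theory Defs
  imports "HOL-Probability.Probability"
begin

text \<open>
  A walk is the list of its altitudes, so a walk of length \<open>n\<close> is a list with \<open>n + 1\<close> entries.
  The weights \<open>p\<^bsub>-1\<^esub>, p\<^bsub>0\<^esub>, p\<^bsub>1\<^esub>\<close> are the values of \<open>p :: int \<Rightarrow> real\<close> at the three possible steps;
  other values of \<open>p\<close> are never used.
\<close>

definition motzkin_walks :: "nat \<Rightarrow> int list set" where
  "motzkin_walks n = {w. length w = n + 1 \<and> w ! 0 = 0 \<and>
     (\<forall>i\<in>{1..n}. w ! i - w ! (i - 1) \<in> {-1, 0, 1})}"

definition walk_weight :: "(int \<Rightarrow> real) \<Rightarrow> int list \<Rightarrow> real" where
  "walk_weight p w = (\<Prod>i\<in>{1..<length w}. p (w ! i - w ! (i - 1)))"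

definition jump_poly :: "(int \<Rightarrow> real) \<Rightarrow> real \<Rightarrow> real" where
  "jump_poly p u = p (-1) * inverse u + p 0 + p 1 * u"

definition drift :: "(int \<Rightarrow> real) \<Rightarrow> real" where
  "drift p = deriv (jump_poly p) 1"

definition random_walk :: "(int \<Rightarrow> real) \<Rightarrow> nat \<Rightarrow> int list measure" where
  "random_walk p n = point_measure (motzkin_walks n)
     (\<lambda>w. ennreal (walk_weight p w / (\<Sum>v\<in>motzkin_walks n. walk_weight p v)))"

definition returns_to_zero :: "int list \<Rightarrow> nat" where
  "returns_to_zero w = card {i. 1 \<le> i \<and> i < length w \<and> w ! i = 0}"

definition half_normal :: "real \<Rightarrow> real measure" where
  "half_normal \<sigma> = density lborel
     (\<lambda>x. ennreal (if 0 \<le> x then sqrt (2 / (pi * \<sigma>\<^sup>2)) * exp (- x\<^sup>2 / (2 * \<sigma>\<^sup>2)) else 0))"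

lemma motzkin_walks_0: "motzkin_walks 0 = {[0]}"
  by (auto simp: motzkin_walks_def length_Suc_conv)

lemma motzkin_walks_Suc:
  "bij_betw (\<lambda>(w, s). w @ [last w + s]) (motzkin_walks n \<times> {-1, 0, 1}) (motzkin_walks (Suc n))"
proof (rule bij_betw_byWitness[where f' = "\<lambda>w. (butlast w, w ! Suc n - w ! n)"])
  have last: "last w = w ! n" if "length w = n + 1" for w :: "int list"
    using that by (cases w) (auto simp: last_conv_nth)
  show "\<forall>a\<in>motzkin_walks n \<times> {-1, 0, 1}. (\<lambda>w. (butlast w, w ! Suc n - w ! n))
      ((\<lambda>(w, s). w @ [last w + s]) a) = a"
    by (auto simp: motzkin_walks_def nth_append last)
  show "\<forall>w\<in>motzkin_walks (Suc n). (\<lambda>(w, s). w @ [last w + s]) (butlast w, w ! Suc n - w ! n) = w"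
  proof
    fix w assume w: "w \<in> motzkin_walks (Suc n)"
    then have l: "length w = n + 2" by (auto simp: motzkin_walks_def)
    then have "last (butlast w) = w ! n" by (subst last) (auto simp: nth_butlast)
    moreover have "w \<noteq> []" using l by auto
    moreover from this have "last w = w ! Suc n" using l by (simp add: last_conv_nth)
    ultimately show "(\<lambda>(w, s). w @ [last w + s]) (butlast w, w ! Suc n - w ! n) = w"
      using append_butlast_last_id[of w] by simp
  qed
  show "(\<lambda>(w, s). w @ [last w + s]) ` (motzkin_walks n \<times> {-1, 0, 1}) \<subseteq> motzkin_walks (Suc n)"
  proof (rule image_subsetI, clarify del: insertE)
    fix w :: "int list" and s :: int assume w: "w \<in> motzkin_walks n" and s: "s \<in> {-1, 0, 1}"
    then have l: "length w = n + 1" by (auto simp: motzkin_walks_def)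
    show "w @ [last w + s] \<in> motzkin_walks (Suc n)"
      using w s unfolding motzkin_walks_def last[OF l]
      by (auto simp: nth_append le_Suc_eq)
  qed
  show "(\<lambda>w. (butlast w, w ! Suc n - w ! n)) ` motzkin_walks (Suc n) \<subseteq> motzkin_walks n \<times> {-1, 0, 1}"
  proof (rule image_subsetI)
    fix w assume w: "w \<in> motzkin_walks (Suc n)"
    then have l: "length w = n + 2" by (auto simp: motzkin_walks_def)
    have "w ! i - w ! (i - 1) \<in> {-1, 0, 1}" if "i \<in> {1..n}" for i
      using w that unfolding motzkin_walks_def by auto
    moreover have "butlast w ! i - butlast w ! (i - 1) = w ! i - w ! (i - 1)" if "i \<in> {1..n}" for i
    proof -
      have "i < length (butlast w)" "i - 1 < length (butlast w)" using that l by auto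
      then show ?thesis by (simp only: nth_butlast)
    qed
    moreover have "length (butlast w) = n + 1" "butlast w ! 0 = 0"
      using w l by (auto simp: motzkin_walks_def nth_butlast)
    ultimately have "butlast w \<in> motzkin_walks n"
      unfolding motzkin_walks_def by (simp only: mem_Collect_eq) simp
    moreover have "\<forall>i\<in>{1..Suc n}. w ! i - w ! (i - 1) \<in> {-1, 0, 1}"
      using w unfolding motzkin_walks_def by blast
    from this[THEN bspec, of "Suc n"] have "w ! Suc n - w ! n \<in> {-1, 0, 1}" by simp
    ultimately show "(butlast w, w ! Suc n - w ! n) \<in> motzkin_walks n \<times> {-1, 0, 1}"
      by blast
  qed
qed

lemma finite_motzkin_walks: "finite (motzkin_walks n)"
proof (induction n)
  case (Suc n)
  then show ?case using bij_betw_finite[OF motzkin_walks_Suc[of n]] by simp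
qed (simp add: motzkin_walks_0)

lemma walk_weight_snoc:
  assumes "w \<in> motzkin_walks n"
  shows "walk_weight p (w @ [last w + s]) = walk_weight p w * p s"
proof -
  have l: "length w = Suc n" using assms by (auto simp: motzkin_walks_def)
  then have "last w = w ! n" by (cases w) (auto simp: last_conv_nth)
  have "(\<Prod>i\<in>{1..<Suc n}. p ((w @ [w ! n + s]) ! i - (w @ [w ! n + s]) ! (i - 1)))
      = (\<Prod>i\<in>{1..<Suc n}. p (w ! i - w ! (i - 1)))"
    using l by (intro prod.cong refl arg_cong[where f = p]) (auto simp: nth_append)
  moreover have "{1..<Suc (Suc n)} = insert (Suc n) {1..<Suc n}" by auto
  moreover have "(w @ [w ! n + s]) ! Suc n - (w @ [w ! n + s]) ! n = s"
    using l by (simp add: nth_append)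
  ultimately show ?thesis using l \<open>last w = w ! n\<close>
    unfolding walk_weight_def by (simp add: mult.commute)
qed

lemma sum_walk_weight:
  "(\<Sum>w\<in>motzkin_walks n. walk_weight p w) = jump_poly p 1 ^ n"
proof (induction n)
  case 0
  show ?case by (simp add: motzkin_walks_0 walk_weight_def)
next
  case (Suc n)
  have "(\<Sum>w\<in>motzkin_walks (Suc n). walk_weight p w)
      = (\<Sum>(w, s)\<in>motzkin_walks n \<times> {-1, 0, 1}. walk_weight p (w @ [last w + s]))"
    by (subst sum.reindex_bij_betw[OF motzkin_walks_Suc, symmetric]) (simp add: case_prod_beta)
  also have "\<dots> = (\<Sum>(w, s)\<in>motzkin_walks n \<times> {-1, 0, 1}. walk_weight p w * p s)"
    by (intro sum.cong refl) (auto simp only: walk_weight_snoc split: prod.splits)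
  also have "\<dots> = (\<Sum>w\<in>motzkin_walks n. walk_weight p w) * (\<Sum>s\<in>{-1, 0, 1}. p s)"
    by (simp only: sum.cartesian_product[symmetric] sum_product)
  also have "(\<Sum>s\<in>{-1, 0, 1}. p s) = jump_poly p 1"
    by (simp add: jump_poly_def)
  finally show ?case using Suc by (simp add: mult.commute)
qed

lemma prob_space_random_walk:
  assumes "p (-1) > 0" and "p 0 > 0" and "p 1 > 0"
  shows "prob_space (random_walk p n)"
proof
  let ?S = "\<Sum>v\<in>motzkin_walks n. walk_weight p v"
  have "jump_poly p 1 > 0" using assms by (simp add: jump_poly_def)
  then have S: "?S > 0" by (simp add: sum_walk_weight)
  have nonneg: "walk_weight p w \<ge> 0" if "w \<in> motzkin_walks n" for w
    unfolding walk_weight_def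
  proof (rule prod_nonneg)
    fix i assume "i \<in> {1..<length w}"
    then have "w ! i - w ! (i - 1) \<in> {-1, 0, 1}"
      using that unfolding motzkin_walks_def by auto
    then show "0 \<le> p (w ! i - w ! (i - 1))" using assms by auto
  qed
  have "emeasure (random_walk p n) (space (random_walk p n))
      = (\<Sum>w\<in>motzkin_walks n. ennreal (walk_weight p w / ?S))"
    unfolding random_walk_def space_point_measure
    by (intro emeasure_point_measure_finite finite_motzkin_walks) simp
  also have "\<dots> = ennreal (\<Sum>w\<in>motzkin_walks n. walk_weight p w / ?S)"
    using S nonneg by (intro sum_ennreal) auto
  also have "\<dots> = 1" using S by (simp flip: sum_divide_distrib)
  finally show "emeasure (random_walk p n) (space (random_walk p n)) = 1" .
qed

end

theory Submission
  imports Defs "HOL-Real_Asymp.Real_Asymp"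
begin

text \<open>
  Divide the weights by \<open>P(1)\<close>, so that the steps become independent with probabilities
  \<open>q\<^bsub>-1\<^esub>, q\<^bsub>0\<^esub>, q\<^bsub>1\<^esub>\<close>. The probability \<open>return_tail q n x k\<close> that a walk started at altitude \<open>x\<close>
  returns to zero at least \<open>k\<close> times within \<open>n\<close> steps obeys a recursion in its first step, and both
  parts are statements about the solution of this recursion at \<open>x = 0\<close>.

  If the drift is not zero, say \<open>q\<^bsub>1\<^esub> > q\<^bsub>-1\<^esub>\<close>, the walk is transient. By the gambler's ruin formula it
  reaches 0 almost surely from below, and from \<open>x > 0\<close> with probability \<open>(q\<^bsub>-1\<^esub> / q\<^bsub>1\<^esub>)\<^sup>x\<close>. So from 0
  it returns with probability
  \<open>\<rho> = q\<^bsub>-1\<^esub> + q\<^bsub>0\<^esub> + q\<^bsub>1\<^esub> (q\<^bsub>-1\<^esub> / q\<^bsub>1\<^esub>) = 1 - (q\<^bsub>1\<^esub> - q\<^bsub>-1\<^esub>)\<close>, every return is a fresh start, and the number of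
  returns in infinite time exceeds \<open>k - 1\<close> with probability \<open>\<rho>\<^sup>k\<close>. The probabilities for \<open>n\<close> steps
  increase to this value, because a harmonic function that vanishes at 0 and has the right behaviour
  at infinity is zero (\<open>half_line_recurrence_vanishes\<close>).

  If the drift is zero, put \<open>v = 2 q\<^bsub>1\<^esub> = 2 q\<^bsub>-1\<^esub>\<close>, the variance of a step. A return to 0 takes either
  one null step, or one step to a neighbour (probability \<open>v\<close>) followed by the first passage of a
  walk over one level. Hence the time of the \<open>k\<close>-th return is distributed like
  \<open>k\<close> plus the first passage time of a level \<open>B\<^sub>k\<close>, a binomial variable with parameters \<open>k\<close> and \<open>v\<close>
  that is independent of the walk, and the reflection principle gives, for \<open>k \<le> n\<close>, the exact formula
  \<open>P(X\<^sub>n \<ge> k) = P(S\<^bsub>n-k\<^esub> + B\<^sub>k \<le> 0) + P(S\<^bsub>n-k\<^esub> + B\<^sub>k \<le> -1)\<close>,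
  where \<open>S\<close> is the walk itself (\<open>return_tail_eq_comparison_tail\<close>). Let \<open>k\<close> be asymptotic to \<open>x \<surd>n\<close>. By
  the continuity theorem for characteristic functions, \<open>(S\<^bsub>n-k\<^esub> + B\<^sub>k) / \<surd>n\<close> converges to a normal
  variable of mean \<open>v x\<close> and variance \<open>v\<close>: the walk contributes the fluctuations and the binomial
  variable only its mean (\<open>tendsto_prob_comparison_pmf\<close>). Both probabilities therefore tend to the
  value of the standard normal distribution function at \<open>- x \<surd>v\<close>, and twice this value is the tail
  at \<open>x\<close> of the half-normal distribution with parameter \<open>1 / \<surd>v\<close> (\<open>cdf_half_normal\<close>).
\<close>

section \<open>The first-step recursion for the number of returns\<close>

text \<open>
  The clock runs over the remaining steps, so the recursion splits off the first step. When that step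
  ends at 0 one return has been used up; the truncated predecessor turns "at least 0 returns" into
  itself.
\<close>

primrec return_tail :: "(int \<Rightarrow> real) \<Rightarrow> nat \<Rightarrow> int \<Rightarrow> nat \<Rightarrow> real" where
  "return_tail q 0 x k = of_bool (k = 0)"
| "return_tail q (Suc n) x k =
     (\<Sum>s\<in>{-1, 0, 1}. q s * return_tail q n (x + s) (if x + s = 0 then k - 1 else k))"

lemma returns_to_zero_snoc:
  assumes "w \<noteq> []"
  shows "returns_to_zero (w @ [y]) = returns_to_zero w + of_bool (y = 0)"
proof -
  have "{i. 1 \<le> i \<and> i < length (w @ [y]) \<and> (w @ [y]) ! i = 0}
      = {i. 1 \<le> i \<and> i < length w \<and> w ! i = 0} \<union> (if y = 0 then {length w} else {})"
    using assms by (auto simp: nth_append less_Suc_eq Suc_le_eq)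
  moreover have "card ({i. 1 \<le> i \<and> i < length w \<and> w ! i = 0} \<union> {length w})
      = Suc (card {i. 1 \<le> i \<and> i < length w \<and> w ! i = 0})"
    by simp
  ultimately show ?thesis unfolding returns_to_zero_def by simp
qed

text \<open>
  The Markov property at time \<open>n\<close>: average, over the first \<open>n\<close> steps, the chance of collecting the
  missing returns in the last \<open>m\<close> ones. Keeping \<open>m\<close> general reconciles the two directions of
  recursion, since walks grow at their end while \<open>return_tail\<close> consumes the first step.
\<close>

lemma sum_walks_return_tail:
  fixes p :: "int \<Rightarrow> real"
  assumes "jump_poly p 1 \<noteq> 0"
  defines "q \<equiv> \<lambda>s. p s / jump_poly p 1"
  shows "(\<Sum>w\<in>motzkin_walks n. walk_weight p w / jump_poly p 1 ^ n
            * return_tail q m (last w) (k - returns_to_zero w)) = return_tail q (n + m) 0 k"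
proof (induction n arbitrary: m)
  case 0
  have "returns_to_zero [0] = 0" unfolding returns_to_zero_def by (subst card_eq_0_iff) auto
  then show ?case by (simp add: motzkin_walks_0 walk_weight_def)
next
  case (Suc n)
  let ?P = "jump_poly p 1"
  have "(\<Sum>w\<in>motzkin_walks (Suc n). walk_weight p w / ?P ^ Suc n
            * return_tail q m (last w) (k - returns_to_zero w))
      = (\<Sum>(w, s)\<in>motzkin_walks n \<times> {-1, 0, 1}. walk_weight p (w @ [last w + s]) / ?P ^ Suc n
            * return_tail q m (last w + s) (k - returns_to_zero (w @ [last w + s])))"
    by (subst sum.reindex_bij_betw[OF motzkin_walks_Suc, symmetric]) (simp add: case_prod_beta)
  also have "\<dots> = (\<Sum>(w, s)\<in>motzkin_walks n \<times> {-1, 0, 1}. walk_weight p w / ?P ^ n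
      * (q s * return_tail q m (last w + s)
          (if last w + s = 0 then k - returns_to_zero w - 1 else k - returns_to_zero w)))"
  proof (intro sum.cong refl, clarify del: insertE)
    fix w :: "int list" and s :: int assume w: "w \<in> motzkin_walks n"
    then have "w \<noteq> []" by (auto simp: motzkin_walks_def)
    then show "walk_weight p (w @ [last w + s]) / ?P ^ Suc n
            * return_tail q m (last w + s) (k - returns_to_zero (w @ [last w + s]))
        = walk_weight p w / ?P ^ n * (q s * return_tail q m (last w + s)
          (if last w + s = 0 then k - returns_to_zero w - 1 else k - returns_to_zero w))"
      using w by (simp add: walk_weight_snoc returns_to_zero_snoc q_def mult.assoc mult.commute[of ?P])
  qed
  also have "\<dots> = (\<Sum>w\<in>motzkin_walks n. walk_weight p w / ?P ^ n
            * return_tail q (Suc m) (last w) (k - returns_to_zero w))"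
    by (simp only: sum.cartesian_product[symmetric] sum_distrib_left return_tail.simps)
  also have "\<dots> = return_tail q (Suc n + m) 0 k" by (subst Suc) simp
  finally show ?case .
qed

lemma measure_random_walk_returns:
  fixes p :: "int \<Rightarrow> real"
  assumes p: "p (-1) > 0" "p 0 > 0" "p 1 > 0"
  shows "measure (random_walk p n) {w \<in> motzkin_walks n. k \<le> returns_to_zero w}
       = return_tail (\<lambda>s. p s / jump_poly p 1) n 0 k"
proof -
  have P: "jump_poly p 1 > 0" using p by (simp add: jump_poly_def)
  have nonneg: "walk_weight p w \<ge> 0" if "w \<in> motzkin_walks n" for w
    unfolding walk_weight_def
  proof (rule prod_nonneg)
    fix i assume "i \<in> {1..<length w}"
    then have "w ! i - w ! (i - 1) \<in> {-1, 0, 1}"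
      using that unfolding motzkin_walks_def by auto
    then show "0 \<le> p (w ! i - w ! (i - 1))" using p by auto
  qed
  let ?A = "{w \<in> motzkin_walks n. k \<le> returns_to_zero w}"
  have "emeasure (random_walk p n) ?A = (\<Sum>w\<in>?A. ennreal (walk_weight p w / jump_poly p 1 ^ n))"
    unfolding random_walk_def sum_walk_weight
    by (intro emeasure_point_measure_finite finite_motzkin_walks) simp
  also have "\<dots> = ennreal (\<Sum>w\<in>?A. walk_weight p w / jump_poly p 1 ^ n)"
    using P nonneg by (intro sum_ennreal) auto
  finally have "measure (random_walk p n) ?A = (\<Sum>w\<in>?A. walk_weight p w / jump_poly p 1 ^ n)"
    unfolding measure_def using P nonneg by (auto intro!: enn2real_ennreal sum_nonneg)
  also have "\<dots> = (\<Sum>w\<in>motzkin_walks n. walk_weight p w / jump_poly p 1 ^ n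
      * return_tail (\<lambda>s. p s / jump_poly p 1) 0 (last w) (k - returns_to_zero w))"
    by (intro sum.mono_neutral_cong_left finite_motzkin_walks) auto
  also have "\<dots> = return_tail (\<lambda>s. p s / jump_poly p 1) n 0 k"
    using sum_walks_return_tail[of p n 0 k] P by simp
  finally show ?thesis .
qed

lemma return_tail_no_returns:
  assumes "q (-1) + q 0 + q 1 = (1::real)"
  shows "return_tail q n x 0 = 1"
  using assms by (induction n arbitrary: x) (simp_all add: algebra_simps)

lemma return_tail_nonneg:
  assumes "q (-1) \<ge> 0" "q 0 \<ge> 0" "q 1 \<ge> 0"
  shows "return_tail q n x k \<ge> 0"
  using assms by (induction n arbitrary: x k) auto

lemma return_tail_mono:
  assumes "q (-1) \<ge> 0" "q 0 \<ge> 0" "q 1 \<ge> 0" "q (-1) + q 0 + q 1 = 1"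
  shows "return_tail q n x k \<le> return_tail q (Suc n) x k"
proof (induction n arbitrary: x k)
  case 0
  show ?case
  proof (cases "k = 0")
    case True
    then show ?thesis using return_tail_no_returns[OF assms(4), of "Suc 0" x] by simp
  next
    case False
    then show ?thesis using return_tail_nonneg[OF assms(1-3), of "Suc 0" x k] by simp
  qed
next
  case (Suc n)
  have "q s \<ge> 0" if "s \<in> {-1, 0, 1}" for s using that assms by auto
  then have "(\<Sum>s\<in>{-1, 0, 1}. q s * return_tail q n (x + s) (if x + s = 0 then k - 1 else k))
      \<le> (\<Sum>s\<in>{-1, 0, 1}. q s * return_tail q (Suc n) (x + s) (if x + s = 0 then k - 1 else k))"
    by (intro sum_mono mult_left_mono Suc.IH)
  then show ?case by (simp only: return_tail.simps(2)[symmetric])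
qed

lemma return_tail_reflect:
  "return_tail (\<lambda>s. q (- s)) n x k = return_tail q n (- x) k"
proof (induction n arbitrary: x k)
  case (Suc n)
  have "x = 1 \<longleftrightarrow> - x = -1" "x = -1 \<longleftrightarrow> - x = 1" by auto
  with Suc show ?case by (auto simp: algebra_simps)
qed simp

text \<open>
  This covers both scalings: \<open>h\<close> is the identity for nonzero drift and the division by \<open>\<surd>n\<close> for zero
  drift.
\<close>

lemma cdf_returns:
  fixes p :: "int \<Rightarrow> real"
  assumes p: "p (-1) > 0" "p 0 > 0" "p 1 > 0"
    and below: "\<And>j. h (real j) \<le> x \<longleftrightarrow> j < k"
  shows "cdf (distr (random_walk p n) borel (\<lambda>w. h (real (returns_to_zero w)))) x
       = 1 - return_tail (\<lambda>s. p s / jump_poly p 1) n 0 k"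
proof -
  interpret prob_space "random_walk p n" by (rule prob_space_random_walk[OF p])
  have space: "space (random_walk p n) = motzkin_walks n"
    and sets: "sets (random_walk p n) = Pow (motzkin_walks n)"
    by (simp_all add: random_walk_def space_point_measure sets_point_measure)
  have meas: "(\<lambda>w. h (real (returns_to_zero w))) \<in> borel_measurable (random_walk p n)"
    unfolding measurable_def by (auto simp: space sets)
  have "cdf (distr (random_walk p n) borel (\<lambda>w. h (real (returns_to_zero w)))) x
      = prob (space (random_walk p n) - {w \<in> motzkin_walks n. k \<le> returns_to_zero w})"
    unfolding cdf_def by (subst measure_distr[OF meas])
      (auto intro!: arg_cong[where f = prob] simp: space below)
  also have "\<dots> = 1 - prob {w \<in> motzkin_walks n. k \<le> returns_to_zero w}"
    by (rule prob_compl) (auto simp: sets)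
  finally show ?thesis by (simp only: measure_random_walk_returns[OF p])
qed

lemma cdf_returns_negative:
  fixes p :: "int \<Rightarrow> real"
  assumes p: "p (-1) > 0" "p 0 > 0" "p 1 > 0" and "x < 0" and h: "\<And>j. h (real j) \<ge> 0"
  shows "cdf (distr (random_walk p n) borel (\<lambda>w. h (real (returns_to_zero w)))) x = 0"
proof -
  have "jump_poly p 1 \<noteq> 0" "p (-1) + p 0 + p 1 = jump_poly p 1"
    using p by (simp_all add: jump_poly_def)
  then have "return_tail (\<lambda>s. p s / jump_poly p 1) n 0 0 = 1"
    by (intro return_tail_no_returns) (simp flip: add_divide_distrib)
  moreover have "\<not> h (real j) \<le> x" for j using \<open>x < 0\<close> h[of j] by linarith
  ultimately show ?thesis by (subst cdf_returns[OF p, of h x 0]) auto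
qed


section \<open>Nonzero drift\<close>

text \<open>
  The increments of \<open>a\<close> form a geometric sequence with ratio \<open>\<alpha> / \<beta>\<close>. If the ratio is at least 1, then
  \<open>a\<close> grows at least linearly unless it vanishes. Otherwise \<open>a\<close> converges to a nonzero multiple of
  \<open>a 1\<close>, and only there is decay at infinity required to force \<open>a 1 = 0\<close>.
\<close>

lemma half_line_recurrence_vanishes:
  fixes a :: "nat \<Rightarrow> real"
  assumes ab: "\<alpha> > 0" "\<beta> > 0" and a0: "a 0 = 0"
    and rec: "\<And>m. (\<alpha> + \<beta>) * a (Suc m) = \<alpha> * a m + \<beta> * a (Suc (Suc m))"
    and bound: "\<And>m. \<bar>a m\<bar> \<le> C"
    and decay: "\<alpha> < \<beta> \<Longrightarrow> a \<longlonglongrightarrow> 0"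
  shows "a m = 0"
proof -
  define r where "r = \<alpha> / \<beta>"
  have r: "r > 0" using ab by (simp add: r_def)
  have diff: "a (Suc m) - a m = r ^ m * a 1" for m
  proof (induction m)
    case (Suc m)
    have "\<beta> * (a (Suc (Suc m)) - a (Suc m)) = \<alpha> * (a (Suc m) - a m)"
      using rec[of m] by (simp add: algebra_simps)
    then have "a (Suc (Suc m)) - a (Suc m) = r * (a (Suc m) - a m)"
      using ab by (simp add: r_def field_simps)
    then show ?case using Suc by simp
  qed (simp add: a0)
  have sum: "a m = a 1 * (\<Sum>i<m. r ^ i)" for m
  proof (induction m)
    case (Suc m) then show ?case using diff[of m] by (simp add: algebra_simps)
  qed (simp add: a0)
  have "a 1 = 0"
  proof (cases "\<alpha> < \<beta>")
    case True
    then have "norm r < 1" using ab r by (simp add: r_def)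
    then have "(\<lambda>m. a 1 * (\<Sum>i<m. r ^ i)) \<longlonglongrightarrow> a 1 * (1 / (1 - r))"
      using geometric_sums[of r] by (intro tendsto_mult tendsto_const) (simp add: sums_def)
    then have "a \<longlonglongrightarrow> a 1 * (1 / (1 - r))" by (simp only: sum[symmetric])
    then have "a 1 * (1 / (1 - r)) = 0" using decay[OF True] LIMSEQ_unique by blast
    then show ?thesis using \<open>norm r < 1\<close> by auto
  next
    case False
    then have "r \<ge> 1" using ab by (simp add: r_def)
    show ?thesis
    proof (rule ccontr)
      assume "a 1 \<noteq> 0"
      then obtain m where m: "C < real m * \<bar>a 1\<bar>"
        using reals_Archimedean3[of "\<bar>a 1\<bar>"] by auto
      have "real m \<le> (\<Sum>i<m. r ^ i)"
        using sum_mono[of "{..<m}" "\<lambda>_. 1" "\<lambda>i. r ^ i"] \<open>r \<ge> 1\<close> by simp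
      then have "real m * \<bar>a 1\<bar> \<le> \<bar>\<Sum>i<m. r ^ i\<bar> * \<bar>a 1\<bar>"
        by (intro mult_right_mono) auto
      also have "\<dots> = \<bar>a m\<bar>" by (simp only: sum[of m] abs_mult mult.commute)
      finally have "real m * \<bar>a 1\<bar> \<le> \<bar>a m\<bar>" .
      then show False using m bound[of m] by linarith
    qed
  qed
  then show ?thesis by (simp only: sum[of m] mult_zero_left)
qed

text \<open>
  The gambler's ruin value, for \<open>q\<^bsub>1\<^esub> > q\<^bsub>-1\<^esub>\<close>, of the probability of at least \<open>k\<close> returns in infinite
  time: the last factor is the chance of ever entering 0 from \<open>x\<close> at a positive time, and each of the
  remaining \<open>k - 1\<close> returns starts at 0.
\<close>

definition eventual_return :: "(int \<Rightarrow> real) \<Rightarrow> int \<Rightarrow> nat \<Rightarrow> real" where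
  "eventual_return q x k = (if k = 0 then 1 else (1 - (q 1 - q (-1))) ^ (k - 1) *
     (if x = 0 then 1 - (q 1 - q (-1)) else if x > 0 then (q (-1) / q 1) ^ nat x else 1))"

lemma eventual_return_harmonic:
  assumes q: "q (-1) > 0" "q 0 \<ge> 0" "q 1 > q (-1)" "q (-1) + q 0 + q 1 = 1"
  shows "(\<Sum>s\<in>{-1, 0, 1}. q s * eventual_return q (x + s) (if x + s = 0 then k - 1 else k))
       = eventual_return q x k"
proof (cases k)
  case 0
  then show ?thesis using q by (simp add: eventual_return_def)
next
  case (Suc j)
  define \<rho> where "\<rho> = 1 - (q 1 - q (-1))"
  define r where "r = q (-1) / q 1"
  have qr: "q 1 * r = q (-1)" using q by (simp add: r_def)
  have q0: "q 0 = 1 - q 1 - q (-1)" using q by simp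
  \<comment> \<open>Entering 0 uses up a return, and this value continues the formulas of both sides to 0.\<close>
  have U0: "eventual_return q 0 j = \<rho> ^ j"
    by (cases j) (simp_all add: eventual_return_def \<rho>_def)
  have Upos: "eventual_return q y (Suc j) = \<rho> ^ j * r ^ nat y" if "y > 0" for y
    using that by (simp add: eventual_return_def \<rho>_def r_def)
  have Uneg: "eventual_return q y (Suc j) = \<rho> ^ j" if "y < 0" for y
    using that by (simp add: eventual_return_def \<rho>_def)
  have Uzero: "eventual_return q 0 (Suc j) = \<rho> ^ j * \<rho>"
    by (simp add: eventual_return_def \<rho>_def)
  consider "x = 0" | "x < 0" | "x > 0" by linarith
  then show ?thesis
  proof cases
    case 1
    have "(\<Sum>s\<in>{-1, 0, 1}. q s * eventual_return q (x + s) (if x + s = 0 then k - 1 else k))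
        = q (-1) * \<rho> ^ j + q 0 * \<rho> ^ j + \<rho> ^ j * (q 1 * r)"
      using 1 Suc by (simp add: U0 Upos Uneg)
    also have "\<dots> = eventual_return q x k"
      using 1 Suc by (simp add: Uzero qr q0) (simp add: \<rho>_def algebra_simps)
    finally show ?thesis .
  next
    case 2
    then have "eventual_return q (x + s) (if x + s = 0 then k - 1 else k) = \<rho> ^ j"
      if "s \<in> {-1, 0, 1}" for s
      using that Suc by (auto simp: U0 Uneg)
    then have "(\<Sum>s\<in>{-1, 0, 1}. q s * eventual_return q (x + s) (if x + s = 0 then k - 1 else k))
        = (\<Sum>s\<in>{-1, 0, 1}. q s * \<rho> ^ j)"
      by (intro sum.cong) auto
    also have "\<dots> = \<rho> ^ j" by (simp add: q0 algebra_simps)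
    finally show ?thesis using 2 Suc by (simp add: Uneg)
  next
    case 3
    obtain m where m: "x = int (Suc m)"
      by (rule that[of "nat (x - 1)"]) (use 3 in simp)
    have "eventual_return q (x + s) (if x + s = 0 then k - 1 else k) = \<rho> ^ j * r ^ nat (x + s)"
      if "s \<in> {-1, 0, 1}" for s
      using 3 that Suc by (auto simp: U0 Upos)
    then have "(\<Sum>s\<in>{-1, 0, 1}. q s * eventual_return q (x + s) (if x + s = 0 then k - 1 else k))
        = (\<Sum>s\<in>{-1, 0, 1}. q s * (\<rho> ^ j * r ^ nat (x + s)))"
      by (intro sum.cong) auto
    also have "\<dots> = \<rho> ^ j * (q (-1) * r ^ m + q 0 * r ^ Suc m + q 1 * r ^ Suc (Suc m))"
      using m by (simp add: nat_add_distrib algebra_simps)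
    also have "q (-1) * r ^ m + q 0 * r ^ Suc m + q 1 * r ^ Suc (Suc m) = r ^ Suc m"
    proof -
      have "q (-1) * r ^ m + q 0 * r ^ Suc m + q 1 * r ^ Suc (Suc m)
          = q (-1) * r ^ m + q 0 * r ^ Suc m + (q 1 * r) * r ^ Suc m" by simp
      also have "\<dots> = (q 1 * r) * r ^ m + q 0 * r ^ Suc m + q (-1) * r ^ Suc m"
        by (simp only: qr)
      also have "\<dots> = (q 1 + q 0 + q (-1)) * r ^ Suc m" by (simp add: algebra_simps)
      also have "\<dots> = r ^ Suc m" using q by simp
      finally show ?thesis .
    qed
    finally show ?thesis using Upos[OF 3] Suc m by (simp only: nat_int)
  qed
qed

text \<open>
  A harmonic function that dominates the initial values dominates the solution at all times.
\<close>

lemma return_tail_le_eventual_return: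
  assumes q: "q (-1) > 0" "q 0 \<ge> 0" "q 1 > q (-1)" "q (-1) + q 0 + q 1 = 1"
  shows "return_tail q n x k \<le> eventual_return q x k"
proof (induction n arbitrary: x k)
  case 0
  show ?case using q by (auto simp: eventual_return_def)
next
  case (Suc n)
  have "q s \<ge> 0" if "s \<in> {-1, 0, 1}" for s using that q by auto
  then have "return_tail q (Suc n) x k
      \<le> (\<Sum>s\<in>{-1, 0, 1}. q s * eventual_return q (x + s) (if x + s = 0 then k - 1 else k))"
    unfolding return_tail.simps by (intro sum_mono mult_left_mono Suc.IH) auto
  then show ?case using eventual_return_harmonic[OF q, of x k] by simp
qed

text \<open>
  The limit exists by monotonicity and is again harmonic, so its defect \<open>e\<close> from \<open>eventual_return\<close> is
  harmonic too. By induction on \<open>k\<close> the defect vanishes at the boundary point 0 of the two half-lines, and on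
  each of them \<open>half_line_recurrence_vanishes\<close> applies: above 0 the upper bound by
  \<open>eventual_return\<close> supplies decay, below 0 boundedness is enough.
\<close>

lemma return_tail_tendsto_positive_drift:
  assumes q: "q (-1) > 0" "q 0 \<ge> 0" "q 1 > q (-1)" "q (-1) + q 0 + q 1 = 1"
  shows "(\<lambda>n. return_tail q n 0 k) \<longlonglongrightarrow> (1 - (q 1 - q (-1))) ^ k"
proof -
  have q': "q (-1) \<ge> 0" "q 0 \<ge> 0" "q 1 \<ge> 0" using q by auto
  define U where "U = eventual_return q"
  define L where "L x k = lim (\<lambda>n. return_tail q n x k)" for x k
  have lim: "(\<lambda>n. return_tail q n x k) \<longlonglongrightarrow> L x k" for x k
  proof -
    have "incseq (\<lambda>n. return_tail q n x k)"
      by (intro incseq_SucI return_tail_mono q' q)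
    then obtain l where "(\<lambda>n. return_tail q n x k) \<longlonglongrightarrow> l"
      using return_tail_le_eventual_return[OF q, of _ x k] incseq_convergent by metis
    then have "convergent (\<lambda>n. return_tail q n x k)" by (rule convergentI)
    then show ?thesis unfolding L_def by (simp add: convergent_LIMSEQ_iff)
  qed
  define e where "e x k = U x k - L x k" for x k
  have e_le: "e x k \<le> U x k" for x k
    using LIMSEQ_le_const[OF lim[of x k], of 0] return_tail_nonneg[of q, OF q'] by (auto simp: e_def)
  have e_nonneg: "0 \<le> e x k" for x k
    using LIMSEQ_le_const2[OF lim[of x k], of "U x k"] return_tail_le_eventual_return[OF q]
    by (auto simp: e_def U_def)
  have e_harm: "e x k = (\<Sum>s\<in>{-1, 0, 1}. q s * e (x + s) (if x + s = 0 then k - 1 else k))" for x k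
  proof -
    have "(\<lambda>n. return_tail q (Suc n) x k)
        \<longlonglongrightarrow> (\<Sum>s\<in>{-1, 0, 1}. q s * L (x + s) (if x + s = 0 then k - 1 else k))"
      unfolding return_tail.simps by (intro tendsto_sum tendsto_mult tendsto_const lim)
    then have "L x k = (\<Sum>s\<in>{-1, 0, 1}. q s * L (x + s) (if x + s = 0 then k - 1 else k))"
      using LIMSEQ_Suc[OF lim[of x k]] LIMSEQ_unique by blast
    then show ?thesis
      unfolding e_def U_def by (subst eventual_return_harmonic[OF q, symmetric])
        (simp only: right_diff_distrib sum_subtractf)
  qed
  have r: "0 < q (-1) / q 1" "q (-1) / q 1 < 1" using q by auto
  have "e 0 k = 0" for k
  proof (induction k)
    case 0
    show ?case using return_tail_no_returns[of q, OF q(4)]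
      by (simp add: e_def U_def eventual_return_def L_def)
  next
    case (Suc k)
    have q1: "q (-1) + q 1 = 1 - q 0" using q by simp
    have right: "e 1 (Suc k) = 0"
    proof -
      \<comment> \<open>At 0 the return has been counted, so the boundary value is the one for \<open>k\<close>, not for \<open>Suc k\<close>.\<close>
      define a where "a m = (if m = 0 then e 0 k else e (int m) (Suc k))" for m
      have a_step: "a (Suc m) = q (-1) * a m + q 0 * a (Suc m) + q 1 * a (Suc (Suc m))" for m
      proof -
        have "e (int (Suc m)) (Suc k) = q (-1) * e (int m) (if m = 0 then k else Suc k)
            + q 0 * e (int (Suc m)) (Suc k) + q 1 * e (int (Suc (Suc m))) (Suc k)"
          by (subst e_harm) (simp add: add.commute)
        then show ?thesis by (cases m) (simp_all only: a_def if_True if_False simp_thms nat.distinct of_nat_0)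
      qed
      have a_le: "a m \<le> (1 - (q 1 - q (-1))) ^ k * (q (-1) / q 1) ^ m" for m
        using Suc e_le[of "int m" "Suc k"] q by (auto simp: a_def U_def eventual_return_def)
      have a_nonneg: "0 \<le> a m" for m using e_nonneg by (simp add: a_def)
      have a_lim: "a \<longlonglongrightarrow> 0"
      proof (rule tendsto_sandwich[OF _ _ tendsto_const])
        show "(\<lambda>m. (1 - (q 1 - q (-1))) ^ k * (q (-1) / q 1) ^ m) \<longlonglongrightarrow> 0"
          using r by (intro tendsto_mult_right_zero LIMSEQ_realpow_zero) auto
      qed (use a_le a_nonneg in auto)
      have "a 1 = 0"
      proof (rule half_line_recurrence_vanishes[of "q (-1)" "q 1" a "(1 - (q 1 - q (-1))) ^ k"])
        show "a 0 = 0" using Suc by (simp add: a_def)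
        show "(q (-1) + q 1) * a (Suc m) = q (-1) * a m + q 1 * a (Suc (Suc m))" for m
          unfolding q1 left_diff_distrib using a_step[of m] by linarith
        have "(1 - (q 1 - q (-1))) ^ k * (q (-1) / q 1) ^ m \<le> (1 - (q 1 - q (-1))) ^ k * 1" for m
          using q r by (intro mult_left_mono power_le_one) auto
        then show "\<bar>a m\<bar> \<le> (1 - (q 1 - q (-1))) ^ k" for m
          using a_le[of m] a_nonneg[of m] by (smt (verit) mult.right_neutral)
      qed (use q a_lim in auto)
      then show ?thesis by (simp add: a_def)
    qed
    have left: "e (-1) (Suc k) = 0"
    proof -
      define a where "a m = (if m = 0 then e 0 k else e (- int m) (Suc k))" for m
      have a_step: "a (Suc m) = q 1 * a m + q 0 * a (Suc m) + q (-1) * a (Suc (Suc m))" for m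
      proof -
        have "e (- int (Suc m)) (Suc k) = q 1 * e (- int m) (if m = 0 then k else Suc k)
            + q 0 * e (- int (Suc m)) (Suc k) + q (-1) * e (- int (Suc (Suc m))) (Suc k)"
          by (subst e_harm) (simp add: add.commute)
        then show ?thesis
          by (cases m) (simp_all only: a_def if_True if_False simp_thms nat.distinct of_nat_0 minus_zero)
      qed
      have "a 1 = 0"
      proof (rule half_line_recurrence_vanishes[of "q 1" "q (-1)" a "(1 - (q 1 - q (-1))) ^ k"])
        show "a 0 = 0" using Suc by (simp add: a_def)
        show "(q 1 + q (-1)) * a (Suc m) = q 1 * a m + q (-1) * a (Suc (Suc m))" for m
          unfolding q1 add.commute[of "q 1"] left_diff_distrib using a_step[of m] by linarith
        show "\<bar>a m\<bar> \<le> (1 - (q 1 - q (-1))) ^ k" for m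
          using Suc e_le[of "- int m" "Suc k"] e_nonneg[of "- int m" "Suc k"] q
          by (auto simp: a_def U_def eventual_return_def)
      qed (use q in auto)
      then show ?thesis by (simp add: a_def)
    qed
    show ?case using e_harm[of 0 "Suc k"] right left Suc by simp
  qed
  then have "L 0 k = U 0 k" by (simp add: e_def)
  also have "\<dots> = (1 - (q 1 - q (-1))) ^ k"
    by (cases k) (simp_all add: U_def eventual_return_def)
  finally show ?thesis using lim[of 0 k] by simp
qed

lemma return_tail_tendsto_nonzero_drift:
  assumes q: "q (-1) > 0" "q 0 \<ge> 0" "q 1 > 0" "q (-1) + q 0 + q 1 = 1" "q 1 \<noteq> q (-1)"
  shows "(\<lambda>n. return_tail q n 0 k) \<longlonglongrightarrow> (1 - \<bar>q 1 - q (-1)\<bar>) ^ k"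
proof (cases "q (-1) < q 1")
  case True
  then show ?thesis using return_tail_tendsto_positive_drift[of q k] q by simp
next
  case False
  then have "(\<lambda>n. return_tail (\<lambda>s. q (- s)) n 0 k) \<longlonglongrightarrow> (1 - (q (-1) - q 1)) ^ k"
    using return_tail_tendsto_positive_drift[of "\<lambda>s. q (- s)" k] q by (simp add: add_ac)
  moreover have "return_tail (\<lambda>s. q (- s)) n 0 k = return_tail q n 0 k" for n
    using return_tail_reflect[of q n 0 k] by simp
  ultimately show ?thesis using False by simp
qed


lemma cdf_geometric:
  assumes "0 < a" "a \<le> 1"
  shows "cdf (distr (geometric_pmf a) borel real) x
       = (if x < 0 then 0 else 1 - (1 - a) ^ nat (\<lfloor>x\<rfloor> + 1))"
proof -
  have "cdf (distr (geometric_pmf a) borel real) x = measure_pmf.prob (geometric_pmf a) {j. real j \<le> x}"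
    unfolding cdf_def by (subst measure_distr) (auto simp: vimage_def)
  also have "{j. real j \<le> x} = {..<nat (\<lfloor>x\<rfloor> + 1)}"
    by (auto simp: zless_nat_conj) linarith+
  finally have "cdf (distr (geometric_pmf a) borel real) x
      = measure_pmf.prob (geometric_pmf a) {..<nat (\<lfloor>x\<rfloor> + 1)}" .
  moreover have "measure_pmf.prob (geometric_pmf a) {..<m} = 1 - (1 - a) ^ m" for m
    using assms by (subst measure_measure_pmf_finite) (auto simp: sum_distrib_right[symmetric] sum_gp_strict)
  moreover have "nat (\<lfloor>x\<rfloor> + 1) = 0" if "x < 0" using that by linarith
  ultimately show ?thesis by simp
qed


section \<open>Zero drift: an exact formula\<close>

text \<open>
  The distribution of a sum of \<open>r\<close> steps of the driftless walk, which moves with probability \<open>v\<close>, and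
  of \<open>k\<close> independent Bernoulli variables of parameter \<open>v\<close>, one for each return that leaves from 0 by a
  step to a neighbour.
\<close>

fun comparison_pmf :: "real \<Rightarrow> nat \<Rightarrow> nat \<Rightarrow> int pmf" where
  "comparison_pmf v 0 0 = return_pmf 0"
| "comparison_pmf v 0 (Suc k) =
     bind_pmf (comparison_pmf v 0 k) (\<lambda>y. map_pmf (\<lambda>b. y + of_bool b) (bernoulli_pmf v))"
| "comparison_pmf v (Suc r) k = bind_pmf (comparison_pmf v r k) (\<lambda>y.
     bind_pmf (bernoulli_pmf v) (\<lambda>b. if b
       then map_pmf (\<lambda>up. if up then y + 1 else y - 1) (bernoulli_pmf (1 / 2))
       else return_pmf y))"

lemma finite_set_comparison_pmf: "finite (set_pmf (comparison_pmf v r k))"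
  by (induction v r k rule: comparison_pmf.induct) (auto split: if_splits)

lemma expectation_comparison_pmf_Suc_walk:
  fixes f :: "int \<Rightarrow> 'b::{banach, second_countable_topology}"
  assumes v: "0 \<le> v" "v \<le> 1"
  shows "measure_pmf.expectation (comparison_pmf v (Suc r) k) f
       = measure_pmf.expectation (comparison_pmf v r k)
           (\<lambda>y. (1 - v) *\<^sub>R f y + (v / 2) *\<^sub>R (f (y + 1) + f (y - 1)))"
proof -
  let ?W = "comparison_pmf v r k"
  let ?S = "\<lambda>y. bind_pmf (bernoulli_pmf v) (\<lambda>b. if b
       then map_pmf (\<lambda>up. if up then y + 1 else y - 1) (bernoulli_pmf (1 / 2))
       else return_pmf y)"
  have fin: "finite (set_pmf (?S y))" for y by (auto split: if_splits)
  have step: "measure_pmf.expectation (?S y) f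
      = (1 - v) *\<^sub>R f y + (v / 2) *\<^sub>R (f (y + 1) + f (y - 1))" for y
    using v by (subst pmf_expectation_bind[where A = UNIV])
      (auto simp: UNIV_bool integral_measure_pmf[where A = UNIV] scaleR_add_right)
  have "measure_pmf.expectation (comparison_pmf v (Suc r) k) f
      = (\<Sum>y\<in>set_pmf ?W. pmf ?W y *\<^sub>R measure_pmf.expectation (?S y) f)"
    unfolding comparison_pmf.simps
    by (rule pmf_expectation_bind[OF finite_set_comparison_pmf fin]) auto
  also have "\<dots> = measure_pmf.expectation ?W
           (\<lambda>y. (1 - v) *\<^sub>R f y + (v / 2) *\<^sub>R (f (y + 1) + f (y - 1)))"
    unfolding step by (rule integral_measure_pmf[symmetric]) (auto simp: finite_set_comparison_pmf)
  finally show ?thesis .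
qed

text \<open>
  The Bernoulli variables come first in the definition of \<open>comparison_pmf\<close>, yet one more of them
  acts like a last summand, because the summands commute.
\<close>

lemma expectation_comparison_pmf_Suc_bernoulli:
  fixes f :: "int \<Rightarrow> 'b::{banach, second_countable_topology}"
  assumes v: "0 \<le> v" "v \<le> 1"
  shows "measure_pmf.expectation (comparison_pmf v r (Suc k)) f
       = measure_pmf.expectation (comparison_pmf v r k) (\<lambda>y. (1 - v) *\<^sub>R f y + v *\<^sub>R f (y + 1))"
proof (induction r arbitrary: f)
  case 0
  let ?W = "comparison_pmf v 0 k"
  have step: "measure_pmf.expectation (map_pmf (\<lambda>b. y + of_bool b) (bernoulli_pmf v)) f
      = (1 - v) *\<^sub>R f y + v *\<^sub>R f (y + 1)" for y
    using v by (simp add: UNIV_bool integral_measure_pmf[where A = UNIV])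
  have "measure_pmf.expectation (comparison_pmf v 0 (Suc k)) f
      = (\<Sum>y\<in>set_pmf ?W. pmf ?W y *\<^sub>R
          measure_pmf.expectation (map_pmf (\<lambda>b. y + of_bool b) (bernoulli_pmf v)) f)"
    unfolding comparison_pmf.simps
    by (rule pmf_expectation_bind[OF finite_set_comparison_pmf]) auto
  also have "\<dots> = measure_pmf.expectation ?W (\<lambda>y. (1 - v) *\<^sub>R f y + v *\<^sub>R f (y + 1))"
    unfolding step by (rule integral_measure_pmf[symmetric]) (auto simp: finite_set_comparison_pmf)
  finally show ?case .
next
  case (Suc r)
  show ?case
    unfolding expectation_comparison_pmf_Suc_walk[OF v] Suc.IH
    by (intro arg_cong[where f = "integral\<^sup>L _"] ext)
      (simp add: scaleR_add_right add.commute diff_add_eq mult.commute)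
qed

text \<open>
  For \<open>k = 0\<close> and \<open>m \<ge> 0\<close> this is, by the reflection principle, the probability that the walk reaches
  a level \<open>m\<close> within \<open>r\<close> steps; for general \<open>k\<close> the level is raised by the Bernoulli sum.
\<close>

definition comparison_tail :: "real \<Rightarrow> nat \<Rightarrow> nat \<Rightarrow> int \<Rightarrow> real" where
  "comparison_tail v r k m = measure_pmf.prob (comparison_pmf v r k) {.. - m}
                           + measure_pmf.prob (comparison_pmf v r k) {.. - m - 1}"

lemma prob_comparison_pmf_Suc_walk:
  assumes v: "0 \<le> v" "v \<le> 1"
  shows "measure_pmf.prob (comparison_pmf v (Suc r) k) {..m}
       = (1 - v) * measure_pmf.prob (comparison_pmf v r k) {..m}
       + v / 2 * (measure_pmf.prob (comparison_pmf v r k) {..m - 1}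
                + measure_pmf.prob (comparison_pmf v r k) {..m + 1})"
proof -
  let ?E = "measure_pmf.expectation (comparison_pmf v r k)"
  have "indicator {..m} (y + 1) = (indicator {..m - 1} y :: real)"
       "indicator {..m} (y - 1) = (indicator {..m + 1} y :: real)" for y :: int
    by (auto simp: indicator_def)
  then have "measure_pmf.prob (comparison_pmf v (Suc r) k) {..m}
      = ?E (\<lambda>y. (1 - v) * indicator {..m} y
          + v / 2 * (indicator {..m - 1} y + indicator {..m + 1} y))"
    using expectation_comparison_pmf_Suc_walk[OF v, of r k "indicator {..m} :: int \<Rightarrow> real"] by simp
  also have "\<dots> = (1 - v) * ?E (indicator {..m})
      + v / 2 * (?E (indicator {..m - 1}) + ?E (indicator {..m + 1}))"
    by (simp add: integrable_measure_pmf_finite finite_set_comparison_pmf)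
  finally show ?thesis by simp
qed

lemma prob_comparison_pmf_Suc_bernoulli:
  assumes v: "0 \<le> v" "v \<le> 1"
  shows "measure_pmf.prob (comparison_pmf v r (Suc k)) {..m}
       = (1 - v) * measure_pmf.prob (comparison_pmf v r k) {..m}
       + v * measure_pmf.prob (comparison_pmf v r k) {..m - 1}"
proof -
  let ?E = "measure_pmf.expectation (comparison_pmf v r k)"
  have "indicator {..m} (y + 1) = (indicator {..m - 1} y :: real)" for y :: int
    by (auto simp: indicator_def)
  then have "measure_pmf.prob (comparison_pmf v r (Suc k)) {..m}
      = ?E (\<lambda>y. (1 - v) * indicator {..m} y + v * indicator {..m - 1} y)"
    using expectation_comparison_pmf_Suc_bernoulli[OF v, of r k "indicator {..m} :: int \<Rightarrow> real"] by simp
  also have "\<dots> = (1 - v) * ?E (indicator {..m}) + v * ?E (indicator {..m - 1})"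
    by (simp add: integrable_measure_pmf_finite finite_set_comparison_pmf)
  finally show ?thesis by simp
qed

lemma expectation_comparison_pmf_uminus:
  fixes f :: "int \<Rightarrow> 'b::{banach, second_countable_topology}"
  assumes v: "0 \<le> v" "v \<le> 1"
  shows "measure_pmf.expectation (comparison_pmf v r 0) (\<lambda>y. f (- y))
       = measure_pmf.expectation (comparison_pmf v r 0) f"
proof (induction r arbitrary: f)
  case (Suc r)
  show ?case
    unfolding expectation_comparison_pmf_Suc_walk[OF v]
    by (subst (2) Suc.IH[symmetric]) (simp add: add.commute)
qed simp

text \<open>
  The boundary value of the reflection principle: level 0 is reached at once. It expresses the
  symmetry of the walk, as \<open>P(S \<le> 0) + P(S \<le> -1) = P(S \<le> 0) + P(S \<ge> 1)\<close>.
\<close>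

lemma comparison_tail_origin:
  assumes v: "0 \<le> v" "v \<le> 1"
  shows "comparison_tail v r 0 0 = 1"
proof -
  have "indicator {..-1} (- y) = (indicator {1..} y :: real)" for y :: int
    by (auto simp: indicator_def)
  then have "measure_pmf.prob (comparison_pmf v r 0) {..-1}
      = measure_pmf.prob (comparison_pmf v r 0) {1..}"
    using expectation_comparison_pmf_uminus[OF v, of r "indicator {..-1} :: int \<Rightarrow> real"] by simp
  moreover have "{1..} = - {..0::int}" by auto
  ultimately show ?thesis
    using measure_pmf.prob_compl[of "{..0}" "comparison_pmf v r 0"]
    by (simp add: comparison_tail_def Compl_eq_Diff_UNIV)
qed

lemma comparison_tail_Suc_walk:
  assumes v: "0 \<le> v" "v \<le> 1"
  shows "comparison_tail v (Suc r) k m = (1 - v) * comparison_tail v r k m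
       + v / 2 * (comparison_tail v r k (m - 1) + comparison_tail v r k (m + 1))"
proof -
  have eqs: "- (m - 1) = - m + 1" "- m + 1 - 1 = - m" "- m - 1 + 1 = - m" "- (m + 1) = - m - 1"
    by auto
  show ?thesis
    unfolding comparison_tail_def prob_comparison_pmf_Suc_walk[OF v] eqs
    by (simp only: distrib_left)
qed

lemma comparison_tail_Suc_bernoulli:
  assumes v: "0 \<le> v" "v \<le> 1"
  shows "comparison_tail v r (Suc k) m = (1 - v) * comparison_tail v r k m
       + v * comparison_tail v r k (m + 1)"
proof -
  have eqs: "- (m + 1) = - m - 1" by auto
  show ?thesis
    unfolding comparison_tail_def prob_comparison_pmf_Suc_bernoulli[OF v] eqs
    by (simp only: distrib_left)
qed

lemma set_comparison_pmf_no_walk: "set_pmf (comparison_pmf v 0 k) \<subseteq> {0..}"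
  by (induction k) auto

lemma comparison_tail_no_walk:
  assumes "m > 0"
  shows "comparison_tail v 0 k m = 0"
proof -
  have "measure_pmf.prob (comparison_pmf v 0 k) {..l} = 0" if "l < 0" for l :: int
    unfolding measure_pmf_zero_iff using that set_comparison_pmf_no_walk[of v k] by force
  then show ?thesis using assms by (simp add: comparison_tail_def)
qed

text \<open>
  From \<open>x \<noteq> 0\<close> the walk needs the first passage to 0 and then \<open>k\<close> further returns; from 0 it needs \<open>k\<close>
  returns. Each return costs one step of its own, which leaves \<open>n - k\<close> steps for passing over
  \<open>\<bar>x\<bar>\<close> plus the Bernoulli sum. Counting \<open>k\<close> beyond the first passage makes one formula cover both
  cases, also when a step arrives at 0. Away from 0 the recursions agree by
  \<open>comparison_tail_Suc_walk\<close>; at 0 a step to one of the two neighbours is a success of a new Bernoulli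
  variable, which is \<open>comparison_tail_Suc_bernoulli\<close>.
\<close>

lemma return_tail_eq_comparison_tail:
  assumes q: "q (-1) = v / 2" "q 0 = 1 - v" "q 1 = v / 2" and v: "0 \<le> v" "v \<le> 1"
  shows "return_tail q n x (if x = 0 then k else Suc k)
       = (if k \<le> n then comparison_tail v (n - k) k \<bar>x\<bar> else 0)"
proof (induction n arbitrary: x k)
  case 0
  show ?case by (auto simp: comparison_tail_origin[OF v] comparison_tail_no_walk)
next
  case (Suc n)
  have norm: "q (-1) + q 0 + q 1 = 1" using q by simp
  show ?case
  proof (cases "x = 0")
    case False
    have IH: "return_tail q n y (if y = 0 then Suc k - 1 else Suc k)
        = (if k \<le> n then comparison_tail v (n - k) k \<bar>y\<bar> else 0)" for y
      using Suc.IH[of y k] by (simp only: diff_Suc_1)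
    let ?T = "\<lambda>y. comparison_tail v (n - k) k \<bar>y\<bar>"
    have abs: "\<bar>x - 1\<bar> = \<bar>x\<bar> - 1 \<and> \<bar>x + 1\<bar> = \<bar>x\<bar> + 1 \<or> \<bar>x - 1\<bar> = \<bar>x\<bar> + 1 \<and> \<bar>x + 1\<bar> = \<bar>x\<bar> - 1"
      using False by linarith
    then have neighbours: "?T (x - 1) + ?T (x + 1)
        = comparison_tail v (n - k) k (\<bar>x\<bar> - 1) + comparison_tail v (n - k) k (\<bar>x\<bar> + 1)"
      by (elim disjE conjE) simp_all
    have "return_tail q (Suc n) x (Suc k)
        = (if k \<le> n then q (-1) * ?T (x - 1) + q 0 * ?T x + q 1 * ?T (x + 1) else 0)"
      unfolding return_tail.simps IH by simp
    also have "q (-1) * ?T (x - 1) + q 0 * ?T x + q 1 * ?T (x + 1)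
        = (1 - v) * ?T x + v / 2 * (?T (x - 1) + ?T (x + 1))"
      unfolding q by (simp add: distrib_left)
    finally have "return_tail q (Suc n) x (Suc k)
        = (if k \<le> n then comparison_tail v (Suc (n - k)) k \<bar>x\<bar> else 0)"
      unfolding neighbours comparison_tail_Suc_walk[OF v] .
    moreover have "comparison_tail v (Suc n - k) k \<bar>x\<bar> = 0" if "k = Suc n"
      using that False by (simp add: comparison_tail_no_walk)
    ultimately show ?thesis using False by (auto simp: Suc_diff_le le_Suc_eq)
  next
    case True
    show ?thesis
    proof (cases k)
      case 0
      then show ?thesis using True
        by (simp add: return_tail_no_returns[OF norm] comparison_tail_origin[OF v] del: return_tail.simps)
    next
      case (Suc j)
      have IH: "return_tail q n y (if y = 0 then Suc j - 1 else Suc j)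
          = (if j \<le> n then comparison_tail v (n - j) j \<bar>y\<bar> else 0)" for y
        using Suc.IH[of y j] by (simp only: diff_Suc_1)
      have "return_tail q (Suc n) 0 (Suc j)
          = (if j \<le> n then comparison_tail v (n - j) (Suc j) 0 else 0)"
        unfolding return_tail.simps IH comparison_tail_Suc_bernoulli[OF v]
        by (simp add: q field_simps)
      then show ?thesis using True Suc by (simp del: return_tail.simps)
    qed
  qed
qed

section \<open>Zero drift: the normal limit\<close>

text \<open>
  The exponent is not tied to the index, because the limits below raise to the powers \<open>n - k\<^sub>n\<close> and
  \<open>k\<^sub>n\<close> with \<open>k\<^sub>n\<close> of order \<open>\<surd>n\<close>. The reason is that \<open>Ln z\<close> is asymptotic to \<open>z - 1\<close> at 1.
\<close>

lemma tendsto_power_exp: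
  fixes z :: "nat \<Rightarrow> complex" and k :: "nat \<Rightarrow> nat"
  assumes z: "z \<longlonglongrightarrow> 1" and kz: "(\<lambda>n. of_nat (k n) * (z n - 1)) \<longlonglongrightarrow> a"
  shows "(\<lambda>n. z n ^ k n) \<longlonglongrightarrow> exp a"
proof -
  have "(Ln has_field_derivative inverse 1) (at 1)"
    by (rule has_field_derivative_Ln) (simp add: complex_nonpos_Reals_iff)
  then obtain g where g: "\<And>w. Ln w - Ln 1 = g w * (w - 1)" "isCont g 1" "g 1 = 1"
    unfolding CARAT_DERIV by auto
  have "(\<lambda>n. g (z n)) \<longlonglongrightarrow> 1"
    using isCont_tendsto_compose[OF g(2) z] g(3) by simp
  then have "(\<lambda>n. g (z n) * (of_nat (k n) * (z n - 1))) \<longlonglongrightarrow> 1 * a"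
    using kz by (intro tendsto_mult)
  moreover have "g (z n) * (of_nat (k n) * (z n - 1)) = of_nat (k n) * Ln (z n)" for n
    using g(1)[of "z n"] by simp
  ultimately have "(\<lambda>n. exp (of_nat (k n) * Ln (z n))) \<longlonglongrightarrow> exp a"
    by (intro tendsto_exp) simp
  moreover have "\<forall>\<^sub>F n in sequentially. exp (of_nat (k n) * Ln (z n)) = z n ^ k n"
    using tendsto_imp_eventually_ne[OF z one_neq_zero]
  proof eventually_elim
    case (elim n)
    then show ?case by (simp add: exp_of_nat_mult)
  qed
  ultimately show ?thesis using tendsto_cong by fast
qed


lemma char_comparison_pmf:
  assumes v: "0 \<le> v" "v \<le> 1"
  shows "measure_pmf.expectation (comparison_pmf v r k) (\<lambda>y. cis (t * real_of_int y))
       = complex_of_real (1 - v + v * cos t) ^ r * (1 - of_real v + of_real v * cis t) ^ k"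
proof -
  have start: "measure_pmf.expectation (comparison_pmf v 0 k) (\<lambda>y. cis (t * real_of_int y))
      = (1 - of_real v + of_real v * cis t) ^ k" for k
  proof (induction k)
    case (Suc k)
    have "(1 - v) *\<^sub>R cis (t * real_of_int y) + v *\<^sub>R cis (t * real_of_int (y + 1))
        = (1 - of_real v + of_real v * cis t) * cis (t * real_of_int y)" for y
      by (simp add: cis_mult[symmetric] scaleR_conv_of_real algebra_simps)
    then show ?case
      unfolding expectation_comparison_pmf_Suc_bernoulli[OF v] by (simp add: Suc)
  qed simp
  show ?thesis
  proof (induction r)
    case (Suc r)
    have "cis t + cis (- t) = complex_of_real (2 * cos t)" by (simp add: complex_eq_iff)
    then have "(1 - v) *\<^sub>R cis (t * real_of_int y)
          + (v / 2) *\<^sub>R (cis (t * real_of_int (y + 1)) + cis (t * real_of_int (y - 1)))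
        = complex_of_real (1 - v + v * cos t) * cis (t * real_of_int y)" for y
      by (simp add: cis_mult[symmetric] scaleR_conv_of_real field_simps complex_eq_iff cos_add sin_add cos_diff sin_diff)
    then show ?case
      unfolding expectation_comparison_pmf_Suc_walk[OF v] by (simp add: Suc mult.assoc)
  qed (simp add: start)
qed

lemma char_affine_std_normal:
  "char (distr std_normal_distribution borel (\<lambda>z. \<mu> + \<sigma> * z)) t
     = cis (t * \<mu>) * exp (- (complex_of_real (\<sigma> * t))\<^sup>2 / 2)"
proof -
  have "char (distr std_normal_distribution borel (\<lambda>z. \<mu> + \<sigma> * z)) t
      = (CLINT z|std_normal_distribution. iexp (t * \<mu>) * iexp ((\<sigma> * t) * z))"
    unfolding char_def by (subst integral_distr) (simp_all add: algebra_simps exp_add)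
  also have "\<dots> = iexp (t * \<mu>) * char std_normal_distribution (\<sigma> * t)"
    unfolding char_def by (rule integral_mult_right_zero)
  also have "\<dots> = cis (t * \<mu>) * exp (- (complex_of_real (\<sigma> * t))\<^sup>2 / 2)"
    by (simp add: char_std_normal_distribution cis_conv_exp exp_of_real[symmetric])
  finally show ?thesis .
qed

text \<open>
  Here \<open>1 - v + v cos (t / \<surd>n)\<close> is \<open>1 - v t\<^sup>2 / (2 n)\<close> up to smaller terms, and its power, of exponent about \<open>n\<close>,
  converges to the characteristic function of a centred normal variable of variance \<open>v\<close>. The factor of
  the Bernoulli variables is \<open>1 + \<i> v t / \<surd>n\<close> up to smaller terms, and its power, of exponent about \<open>x \<surd>n\<close>,
  converges to a pure shift by \<open>v x\<close>. The constant \<open>c\<close> disappears under the scaling, so the event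
  becomes that the limit is at most 0, which is a continuity point.
\<close>

lemma tendsto_prob_comparison_pmf:
  fixes k :: "nat \<Rightarrow> nat" and c :: int
  assumes v: "0 < v" "v \<le> 1" and k: "(\<lambda>n. real (k n) / sqrt (real n)) \<longlonglongrightarrow> x"
    and le: "\<And>n. k n \<le> n"
  shows "(\<lambda>n. measure_pmf.prob (comparison_pmf v (n - k n) (k n)) {..- c})
     \<longlonglongrightarrow> measure std_normal_distribution {..- (sqrt v * x)}"
proof -
  have v': "0 \<le> v" using v by simp
  interpret N: real_distribution std_normal_distribution by (rule real_dist_normal_dist)
  define M where "M n = distr (comparison_pmf v (n - k n) (k n)) borel
    (\<lambda>y. real_of_int (y + c) / sqrt (real n))" for n
  define M' where "M' = distr std_normal_distribution borel (\<lambda>z. v * x + sqrt v * z)"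
  have factor: "v * x + sqrt v * z = sqrt v * (sqrt v * x + z)" for z
    using v by (simp add: distrib_left flip: mult.assoc)
  have M: "real_distribution (M n)" for n
    unfolding M_def by (intro prob_space.real_distribution_distr measure_pmf.prob_space_axioms) simp
  have M': "real_distribution M'"
    unfolding M'_def by (intro prob_space.real_distribution_distr N.prob_space_axioms) simp
  interpret M': real_distribution M' by (rule M')
  have char_M: "char (M n) t = cis (t / sqrt n * c)
      * (complex_of_real (1 - v + v * cos (t / sqrt n)) ^ (n - k n) * (1 - of_real v + of_real v * cis (t / sqrt n)) ^ k n)"
    for n t
  proof -
    have "iexp (t * (real_of_int (y + c) / sqrt n)) = cis (t / sqrt n * c) * cis (t / sqrt n * y)"
      for y :: int
      by (simp only: cis_conv_exp[symmetric] cis_mult)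
        (simp add: add_divide_distrib distrib_left add.commute mult.commute)
    then have "char (M n) t = measure_pmf.expectation (comparison_pmf v (n - k n) (k n))
        (\<lambda>y. cis (t / sqrt n * c) * cis (t / sqrt n * real_of_int y))"
      unfolding char_def M_def by (subst integral_distr) simp_all
    also have "\<dots> = cis (t / sqrt n * c) * measure_pmf.expectation (comparison_pmf v (n - k n) (k n))
        (\<lambda>y. cis (t / sqrt n * real_of_int y))"
      by (rule integral_mult_right_zero)
    finally show ?thesis unfolding char_comparison_pmf[OF v' v(2)] .
  qed
  have "(\<lambda>n. char (M n) t) \<longlonglongrightarrow> char M' t" for t
  proof -
    have shift: "(\<lambda>n. cis (t / sqrt (real n) * c)) \<longlonglongrightarrow> cis 0"
      by (intro tendsto_cis) real_asymp
    have kn: "(\<lambda>n. real (n - k n) / real n) \<longlonglongrightarrow> 1"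
    proof -
      have "(\<lambda>n. real (k n) / sqrt (real n) * (1 / sqrt (real n))) \<longlonglongrightarrow> x * 0"
        by (intro tendsto_mult k) real_asymp
      then have "(\<lambda>n. 1 - real (k n) / real n) \<longlonglongrightarrow> 1 - 0"
        by (intro tendsto_diff tendsto_const) simp
      moreover have "\<forall>\<^sub>F n in sequentially. 1 - real (k n) / real n = real (n - k n) / real n"
        using eventually_gt_at_top[of 0]
        by eventually_elim (use le in \<open>simp add: of_nat_diff field_simps\<close>)
      ultimately show ?thesis by (simp add: tendsto_cong)
    qed
    have walk: "(\<lambda>n. complex_of_real (1 - v + v * cos (t / sqrt (real n))) ^ (n - k n))
        \<longlonglongrightarrow> exp (complex_of_real (- v * t\<^sup>2 / 2))"
    proof (rule tendsto_power_exp)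
      have "(\<lambda>n. 1 - v + v * cos (t / sqrt (real n))) \<longlonglongrightarrow> 1" by real_asymp
      then show "(\<lambda>n. complex_of_real (1 - v + v * cos (t / sqrt (real n)))) \<longlonglongrightarrow> 1"
        by (metis tendsto_of_real of_real_1)
      have "(\<lambda>n. real n * (v * cos (t / sqrt (real n)) - v)) \<longlonglongrightarrow> - (v * (t * t) / 2)"
        by real_asymp
      then have "(\<lambda>n. real (n - k n) / real n * (real n * (v * cos (t / sqrt (real n)) - v)))
          \<longlonglongrightarrow> 1 * (- (v * (t * t) / 2))"
        by (intro tendsto_mult kn)
      moreover have "\<forall>\<^sub>F n in sequentially.
          real (n - k n) / real n * (real n * (v * cos (t / sqrt (real n)) - v))
          = real (n - k n) * (1 - v + v * cos (t / sqrt (real n)) - 1)"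
        using eventually_gt_at_top[of 0] by eventually_elim simp
      ultimately have "(\<lambda>n. real (n - k n) * (1 - v + v * cos (t / sqrt (real n)) - 1))
          \<longlonglongrightarrow> - v * t\<^sup>2 / 2" by (simp add: tendsto_cong power2_eq_square)
      then have "(\<lambda>n. complex_of_real (real (n - k n) * (1 - v + v * cos (t / sqrt (real n)) - 1)))
          \<longlonglongrightarrow> complex_of_real (- v * t\<^sup>2 / 2)" by (rule tendsto_of_real)
      then show "(\<lambda>n. of_nat (n - k n) * (complex_of_real (1 - v + v * cos (t / sqrt (real n))) - 1))
          \<longlonglongrightarrow> complex_of_real (- v * t\<^sup>2 / 2)" by simp
    qed
    have bern: "(\<lambda>n. (1 - of_real v + of_real v * cis (t / sqrt (real n))) ^ k n)
        \<longlonglongrightarrow> exp (of_real x * (of_real v * (\<i> * of_real t)))"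
    proof (rule tendsto_power_exp)
      have "(\<lambda>n. 1 - of_real v + of_real v * cis (t / sqrt (real n))) \<longlonglongrightarrow> 1 - of_real v + of_real v * cis 0"
        by (intro tendsto_intros) real_asymp
      then show "(\<lambda>n. 1 - of_real v + of_real v * cis (t / sqrt (real n))) \<longlonglongrightarrow> 1" by simp
      have "(\<lambda>n. sqrt (real n) * (cos (t / sqrt (real n)) - 1)) \<longlonglongrightarrow> 0" by real_asymp
      moreover have "(\<lambda>n. sqrt (real n) * sin (t / sqrt (real n))) \<longlonglongrightarrow> t" by real_asymp
      ultimately have "(\<lambda>n. Complex (sqrt (real n) * (cos (t / sqrt (real n)) - 1))
          (sqrt (real n) * sin (t / sqrt (real n)))) \<longlonglongrightarrow> Complex 0 t"
        by (rule tendsto_Complex)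
      moreover have "Complex (sqrt (real n) * (cos (t / sqrt (real n)) - 1))
          (sqrt (real n) * sin (t / sqrt (real n)))
          = of_real (sqrt (real n)) * (cis (t / sqrt (real n)) - 1)" for n
        by (simp add: complex_eq_iff)
      ultimately have rate: "(\<lambda>n. of_real (sqrt (real n)) * (cis (t / sqrt (real n)) - 1))
          \<longlonglongrightarrow> \<i> * of_real t" by (simp add: Complex_eq)
      have "(\<lambda>n. complex_of_real (real (k n) / sqrt (real n))
          * (of_real v * (of_real (sqrt (real n)) * (cis (t / sqrt (real n)) - 1))))
          \<longlonglongrightarrow> of_real x * (of_real v * (\<i> * of_real t))"
        by (rule tendsto_mult[OF tendsto_of_real[OF k] tendsto_mult[OF tendsto_const rate]])
      moreover have "\<forall>\<^sub>F n in sequentially. complex_of_real (real (k n) / sqrt (real n))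
          * (of_real v * (of_real (sqrt (real n)) * (cis (t / sqrt (real n)) - 1)))
          = of_nat (k n) * (1 - of_real v + of_real v * cis (t / sqrt (real n)) - 1)"
        using eventually_gt_at_top[of 0] by eventually_elim (simp add: algebra_simps)
      ultimately show "(\<lambda>n. of_nat (k n) * (1 - of_real v + of_real v * cis (t / sqrt (real n)) - 1))
          \<longlonglongrightarrow> of_real x * (of_real v * (\<i> * of_real t))" by (simp add: tendsto_cong)
    qed
    have "(\<lambda>n. char (M n) t) \<longlonglongrightarrow> cis 0 * (exp (complex_of_real (- v * t\<^sup>2 / 2))
        * exp (of_real x * (of_real v * (\<i> * of_real t))))"
      unfolding char_M by (intro tendsto_mult shift walk bern)
    also have "cis 0 * (exp (complex_of_real (- v * t\<^sup>2 / 2))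
        * exp (of_real x * (of_real v * (\<i> * of_real t)))) = char M' t"
      unfolding M'_def char_affine_std_normal using v
      by (simp add: cis_conv_exp power_mult_distrib mult_ac flip: of_real_power)
    finally show ?thesis .
  qed
  then have "weak_conv_m M M'" by (intro levy_continuity M M')
  moreover have "isCont (cdf M') 0"
  proof -
    have "{z. v * x + sqrt v * z \<in> {0}} = {- (sqrt v * x)}"
      unfolding factor using v by (auto simp: mult_le_0_iff)
    then have "measure M' {0} = measure std_normal_distribution {- (sqrt v * x)}"
      unfolding M'_def by (subst measure_distr) (auto simp: vimage_def)
    also have "\<dots> = 0"
      by (simp add: measure_def emeasure_density nn_integral_null_set)
    finally show ?thesis by (simp add: M'.isCont_cdf)
  qed
  ultimately have "(\<lambda>n. cdf (M n) 0) \<longlonglongrightarrow> cdf M' 0"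
    by (simp add: weak_conv_m_def weak_conv_def)
  moreover have "cdf M' 0 = measure std_normal_distribution {..- (sqrt v * x)}"
  proof -
    have "{z. v * x + sqrt v * z \<in> {..0}} = {..- (sqrt v * x)}"
      unfolding factor using v by (auto simp: mult_le_0_iff)
    then show ?thesis
      unfolding M'_def cdf_def by (subst measure_distr) (auto simp: vimage_def)
  qed
  moreover have "\<forall>\<^sub>F n in sequentially.
      cdf (M n) 0 = measure_pmf.prob (comparison_pmf v (n - k n) (k n)) {..- c}"
    using eventually_gt_at_top[of 0]
  proof eventually_elim
    case (elim n)
    then have "{y. real_of_int (y + c) / sqrt (real n) \<in> {..0}} = {..- c}"
      by (auto simp: divide_le_0_iff)
    then show ?case
      unfolding M_def cdf_def by (subst measure_distr) (auto simp: vimage_def)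
  qed
  ultimately show ?thesis by (simp add: tendsto_cong)
qed

lemma tendsto_return_tail_zero_drift:
  assumes q: "q (-1) = v / 2" "q 0 = 1 - v" "q 1 = v / 2" and v: "0 < v" "v \<le> 1"
    and k: "(\<lambda>n. real (k n) / sqrt (real n)) \<longlonglongrightarrow> x"
  shows "(\<lambda>n. return_tail q n 0 (k n)) \<longlonglongrightarrow> 2 * measure std_normal_distribution {..- (sqrt v * x)}"
proof -
  \<comment> \<open>Truncation makes \<open>n - k' n\<close> a true difference; eventually it changes nothing, as \<open>k n\<close> is at most of order \<open>\<surd>n\<close>.\<close>
  define k' where "k' n = min (k n) n" for n
  have "(\<lambda>n. real (k n) / sqrt (real n) * (1 / sqrt (real n))) \<longlonglongrightarrow> x * 0"
    by (intro tendsto_mult k) real_asymp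
  then have "\<forall>\<^sub>F n in sequentially. real (k n) / sqrt (real n) * (1 / sqrt (real n)) < 1"
    by (rule order_tendstoD) simp
  then have kk': "\<forall>\<^sub>F n in sequentially. k' n = k n"
    using eventually_gt_at_top[of 0] by eventually_elim (simp add: k'_def)
  have "(\<lambda>n. real (k' n) / sqrt (real n)) \<longlonglongrightarrow> x"
  proof (rule Lim_transform_eventually[OF k])
    show "\<forall>\<^sub>F n in sequentially. real (k n) / sqrt (real n) = real (k' n) / sqrt (real n)"
      using kk' by eventually_elim simp
  qed
  then have prob: "(\<lambda>n. measure_pmf.prob (comparison_pmf v (n - k' n) (k' n)) {..- c})
      \<longlonglongrightarrow> measure std_normal_distribution {..- (sqrt v * x)}" for c
    by (intro tendsto_prob_comparison_pmf v) (auto simp: k'_def)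
  have "(\<lambda>n. comparison_tail v (n - k' n) (k' n) 0)
      \<longlonglongrightarrow> measure std_normal_distribution {..- (sqrt v * x)}
        + measure std_normal_distribution {..- (sqrt v * x)}"
  proof -
    have "- 0 - 1 = - (1 :: int)" by simp
    then show ?thesis unfolding comparison_tail_def by (simp only:) (intro tendsto_add prob)
  qed
  moreover have "\<forall>\<^sub>F n in sequentially.
      comparison_tail v (n - k' n) (k' n) 0 = return_tail q n 0 (k n)"
    using kk'
  proof eventually_elim
    case (elim n)
    have "k' n \<le> n" by (simp add: k'_def)
    then show ?case
      using return_tail_eq_comparison_tail[OF q less_imp_le[OF v(1)] v(2), of n 0 "k n"]
      unfolding elim by simp
  qed
  ultimately have "(\<lambda>n. return_tail q n 0 (k n))
      \<longlonglongrightarrow> measure std_normal_distribution {..- (sqrt v * x)}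
        + measure std_normal_distribution {..- (sqrt v * x)}"
    by (rule Lim_transform_eventually)
  then show ?thesis by (simp only: mult_2)
qed


section \<open>The half-normal distribution function\<close>

text \<open>
  Half-normal variables are absolute values of centred normal ones, so the probability of \<open>[0, x]\<close> is twice
  the standard normal probability of \<open>[0, x / \<sigma>]\<close>. Symmetry turns this into a lower tail, the form
  in which the limit of the return probabilities appears.
\<close>

lemma cdf_half_normal:
  assumes "\<sigma> > 0"
  shows "cdf (half_normal \<sigma>) x
    = (if x < 0 then 0 else 1 - 2 * measure std_normal_distribution {..- (x / \<sigma>)})"
proof -
  let ?N = std_normal_distribution
  interpret N: real_distribution ?N by (rule real_dist_normal_dist)
  let ?f = "\<lambda>y. ennreal (if 0 \<le> y then sqrt (2 / (pi * \<sigma>\<^sup>2)) * exp (- y\<^sup>2 / (2 * \<sigma>\<^sup>2)) else 0)"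
  have emeasure: "emeasure (half_normal \<sigma>) {..x} = (\<integral>\<^sup>+y. ?f y * indicator {..x} y \<partial>lborel)"
    unfolding half_normal_def by (rule emeasure_density) auto
  show ?thesis
  proof (cases "x < 0")
    case True
    have "emeasure (half_normal \<sigma>) {..x} = (\<integral>\<^sup>+y. 0 \<partial>(lborel :: real measure))"
      unfolding emeasure using True by (intro nn_integral_cong) (auto simp: indicator_def)
    then show ?thesis using True by (simp add: cdf_def measure_def)
  next
    case False
    have density: "\<sigma> * sqrt (2 / (pi * \<sigma>\<^sup>2)) * exp (- (\<sigma> * z)\<^sup>2 / (2 * \<sigma>\<^sup>2)) = 2 * std_normal_density z"
      for z
    proof -
      have "\<sigma> * sqrt (2 / (pi * \<sigma>\<^sup>2)) = sqrt (2 / pi)"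
        using assms by (simp add: real_sqrt_divide real_sqrt_mult)
      also have "\<dots> = 2 / sqrt (2 * pi)"
        by (simp add: real_sqrt_divide real_sqrt_mult field_simps)
      finally show ?thesis using assms by (simp add: std_normal_density_def power_mult_distrib)
    qed
    have "emeasure (half_normal \<sigma>) {..x}
        = \<bar>\<sigma>\<bar> * (\<integral>\<^sup>+z. ?f (0 + \<sigma> * z) * indicator {..x} (0 + \<sigma> * z) \<partial>lborel)"
      unfolding emeasure using assms by (intro nn_integral_real_affine) auto
    also have "\<dots> = (\<integral>\<^sup>+z. \<bar>\<sigma>\<bar> * (?f (0 + \<sigma> * z) * indicator {..x} (0 + \<sigma> * z)) \<partial>lborel)"
      by (rule nn_integral_cmult[symmetric]) auto
    also have "\<dots> = (\<integral>\<^sup>+z. 2 * (ennreal (std_normal_density z) * indicator {0..x / \<sigma>} z) \<partial>lborel)"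
    proof (intro nn_integral_cong)
      fix z
      have "\<sigma> * z \<le> x \<longleftrightarrow> z \<le> x / \<sigma>" "0 \<le> \<sigma> * z \<longleftrightarrow> 0 \<le> z"
        using assms by (simp_all add: field_simps zero_le_mult_iff)
      moreover have "ennreal \<sigma> * ennreal (sqrt (2 / (pi * \<sigma>\<^sup>2)) * exp (- (\<sigma> * z)\<^sup>2 / (2 * \<sigma>\<^sup>2)))
          = 2 * ennreal (std_normal_density z)"
        using assms density[of z] ennreal_mult[of 2 "std_normal_density z"]
        by (subst ennreal_mult[symmetric]) (auto simp: mult.assoc)
      ultimately show "\<bar>\<sigma>\<bar> * (?f (0 + \<sigma> * z) * indicator {..x} (0 + \<sigma> * z))
          = 2 * (ennreal (std_normal_density z) * indicator {0..x / \<sigma>} z)"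
        using assms by (auto simp: indicator_def)
    qed
    also have "\<dots> = 2 * emeasure ?N {0..x / \<sigma>}"
      by (subst nn_integral_cmult) (auto simp: emeasure_density)
    finally have half: "cdf (half_normal \<sigma>) x = 2 * measure ?N {0..x / \<sigma>}"
      by (simp add: cdf_def measure_def enn2real_mult)
    \<comment> \<open>It remains to use that the standard normal law is symmetric and has no atoms.\<close>
    have sym: "distr ?N borel uminus = ?N"
    proof -
      have "distr ?N borel uminus = density (distr lborel borel uminus) (\<lambda>z. std_normal_density z)"
        by (subst density_distr) (auto simp: normal_density_def)
      then show ?thesis by (simp add: lborel_distr_uminus)
    qed
    have refl: "measure ?N A = measure ?N (uminus -` A)" if "A \<in> sets borel" for A
      by (subst sym[symmetric], subst measure_distr) (use that in auto)
    have atom: "measure ?N {z} = 0" for z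
      by (simp add: measure_def emeasure_density nn_integral_null_set)
    define c where "c = x / \<sigma>"
    have c: "0 \<le> c" using False assms by (simp add: c_def)
    have "measure ?N {..0} = measure ?N {0..}"
      by (subst refl) (auto intro!: arg_cong[where f = "measure ?N"])
    moreover have "measure ?N {0..} = measure ?N {0} + measure ?N {0<..}"
      by (subst N.finite_measure_Union[symmetric]) (auto intro!: arg_cong[where f = "measure ?N"])
    moreover have "measure ?N {..0} + measure ?N {0<..} = 1"
    proof -
      have "{..0} \<union> {0<..} = (UNIV :: real set)" by auto
      then show ?thesis
        using N.prob_space by (subst N.finite_measure_Union[symmetric]) auto
    qed
    ultimately have half_line: "measure ?N {0..} = 1 / 2" using atom[of 0] by simp
    have "measure ?N {..- c} = measure ?N {c..}"
      by (subst refl) (auto intro!: arg_cong[where f = "measure ?N"])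
    moreover have "measure ?N {c..} = measure ?N {c} + measure ?N {c<..}"
      by (subst N.finite_measure_Union[symmetric]) (auto intro!: arg_cong[where f = "measure ?N"])
    moreover have "measure ?N {0..} = measure ?N {0..c} + measure ?N {c<..}"
      using c by (subst N.finite_measure_Union[symmetric]) (auto intro!: arg_cong[where f = "measure ?N"])
    ultimately have "measure ?N {0..c} = 1 / 2 - measure ?N {..- c}"
      using atom[of c] half_line by simp
    then show ?thesis using half False by (simp add: c_def)
  qed
qed


section \<open>Derivatives of the jump polynomial and the limit laws\<close>

lemma has_deriv_jump_poly:
  assumes "u \<noteq> 0"
  shows "(jump_poly p has_real_derivative p 1 - p (-1) * inverse (u\<^sup>2)) (at u)"
  unfolding jump_poly_def using assms
  by (auto intro!: derivative_eq_intros simp: power2_eq_square field_simps)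

lemma drift_eq: "drift p = p 1 - p (-1)"
  unfolding drift_def using DERIV_imp_deriv[OF has_deriv_jump_poly[of 1 p]] by simp

lemma deriv2_jump_poly: "deriv (deriv (jump_poly p)) 1 = 2 * p (-1)"
proof -
  have "((\<lambda>u. p 1 - p (-1) * inverse (u\<^sup>2)) has_real_derivative 2 * p (-1)) (at 1)"
    by (auto intro!: derivative_eq_intros)
  moreover have "\<forall>\<^sub>F u in nhds 1. p 1 - p (-1) * inverse (u\<^sup>2) = deriv (jump_poly p) u"
  proof -
    have "\<forall>\<^sub>F u in nhds 1. u \<noteq> (0::real)" by (rule t1_space_nhds) simp
    then show ?thesis
      by eventually_elim (simp add: DERIV_imp_deriv[OF has_deriv_jump_poly])
  qed
  ultimately have "(deriv (jump_poly p) has_real_derivative 2 * p (-1)) (at 1)"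
    by (metis DERIV_cong_ev)
  then show ?thesis by (rule DERIV_imp_deriv)
qed


theorem theorem4p2:
  fixes p :: "int \<Rightarrow> real"
  assumes "p (-1) > 0" and "p 0 > 0" and "p 1 > 0"
  shows "(drift p \<noteq> 0 \<longrightarrow>
            weak_conv_m
              (\<lambda>n. distr (random_walk p n) borel (\<lambda>w. real (returns_to_zero w)))
              (distr (geometric_pmf (\<bar>p 1 - p (-1)\<bar> / jump_poly p 1)) borel real))
       \<and> (drift p = 0 \<longrightarrow>
            weak_conv_m
              (\<lambda>n. distr (random_walk p n) borel (\<lambda>w. real (returns_to_zero w) / sqrt (real n)))
              (half_normal (sqrt (jump_poly p 1 / deriv (deriv (jump_poly p)) 1))))"
proof (intro conjI impI)
  let ?P = "jump_poly p 1"
  define q where "q = (\<lambda>s. p s / ?P)"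
  have sum_p: "p (-1) + p 0 + p 1 = ?P" by (simp add: jump_poly_def)
  have P: "?P > 0" using assms by (simp flip: sum_p)
  have q: "q (-1) > 0" "q 0 > 0" "q 1 > 0" "q (-1) + q 0 + q 1 = 1"
    using assms P sum_p by (simp_all add: q_def flip: add_divide_distrib)
  {
    assume "drift p \<noteq> 0"
    then have neq: "p 1 \<noteq> p (-1)" by (simp add: drift_eq)
    define a where "a = \<bar>p 1 - p (-1)\<bar> / ?P"
    have a_q: "a = \<bar>q 1 - q (-1)\<bar>"
      using P by (simp add: a_def q_def abs_divide flip: diff_divide_distrib)
    have "0 < a" using neq P by (simp add: a_def)
    moreover have "a \<le> 1" unfolding a_q using q by linarith
    ultimately have a: "0 < a" "a \<le> 1" by auto
    have "(\<lambda>n. cdf (distr (random_walk p n) borel (\<lambda>w. real (returns_to_zero w))) x)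
        \<longlonglongrightarrow> cdf (distr (geometric_pmf a) borel real) x" for x
    proof (cases "x < 0")
      case True
      then show ?thesis
        by (simp add: cdf_geometric[OF a] cdf_returns_negative[OF assms True, of "\<lambda>y. y"])
    next
      case False
      have "real j \<le> x \<longleftrightarrow> j < nat (\<lfloor>x\<rfloor> + 1)" for j using False by linarith
      then have "cdf (distr (random_walk p n) borel (\<lambda>w. real (returns_to_zero w))) x
          = 1 - return_tail q n 0 (nat (\<lfloor>x\<rfloor> + 1))" for n
        unfolding q_def by (rule cdf_returns[OF assms, where h = "\<lambda>y. y"])
      moreover have "(\<lambda>n. 1 - return_tail q n 0 (nat (\<lfloor>x\<rfloor> + 1)))
          \<longlonglongrightarrow> 1 - (1 - a) ^ nat (\<lfloor>x\<rfloor> + 1)"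
        unfolding a_q using q neq P
        by (intro tendsto_diff tendsto_const return_tail_tendsto_nonzero_drift) (auto simp: q_def)
      ultimately show ?thesis using False by (simp add: cdf_geometric[OF a])
    qed
    then show "weak_conv_m (\<lambda>n. distr (random_walk p n) borel (\<lambda>w. real (returns_to_zero w)))
        (distr (geometric_pmf (\<bar>p 1 - p (-1)\<bar> / ?P)) borel real)"
      by (simp add: weak_conv_m_def weak_conv_def a_def)
  next
    assume "drift p = 0"
    then have eq: "p 1 = p (-1)" by (simp add: drift_eq)
    define v where "v = 2 * q 1"
    have qv: "q (-1) = v / 2" "q 0 = 1 - v" "q 1 = v / 2" and v: "0 < v" "v \<le> 1"
      using q eq by (simp_all add: v_def q_def)
    define \<sigma> where "\<sigma> = sqrt (?P / deriv (deriv (jump_poly p)) 1)"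
    have \<sigma>: "\<sigma> = 1 / sqrt v"
      using P eq by (simp add: \<sigma>_def deriv2_jump_poly v_def q_def real_sqrt_divide)
    then have "\<sigma> > 0" using v by simp
    have "(\<lambda>n. cdf (distr (random_walk p n) borel (\<lambda>w. real (returns_to_zero w) / sqrt (real n))) x)
        \<longlonglongrightarrow> cdf (half_normal \<sigma>) x" for x
    proof (cases "x < 0")
      case True
      then show ?thesis
        by (simp add: cdf_half_normal[OF \<open>\<sigma> > 0\<close>]
            cdf_returns_negative[OF assms True, of "\<lambda>y. y / sqrt (real _)"])
    next
      case False
      \<comment> \<open>The least number of returns whose scaled value exceeds \<open>x\<close>.\<close>
      define k where "k n = nat (\<lfloor>x * sqrt (real n)\<rfloor> + 1)" for n
      have "\<forall>\<^sub>F n in sequentially. 1 - return_tail q n 0 (k n)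
          = cdf (distr (random_walk p n) borel (\<lambda>w. real (returns_to_zero w) / sqrt (real n))) x"
        using eventually_gt_at_top[of 0]
      proof eventually_elim
        case (elim n)
        have "0 \<le> x * sqrt (real n)" using False by simp
        then have "real j \<le> x * sqrt (real n) \<longleftrightarrow> j < k n" for j
          unfolding k_def by linarith
        then have "real j / sqrt (real n) \<le> x \<longleftrightarrow> j < k n" for j
          using elim by (simp add: divide_le_eq)
        then show ?case
          unfolding q_def by (rule cdf_returns[OF assms, where h = "\<lambda>y. y / sqrt (real n)", symmetric])
      qed
      moreover have "(\<lambda>n. real (k n) / sqrt (real n)) \<longlonglongrightarrow> x"
      proof (rule tendsto_sandwich)
        show "\<forall>\<^sub>F n in sequentially. x \<le> real (k n) / sqrt (real n)"
          using eventually_gt_at_top[of 0]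
        proof eventually_elim
          case (elim n)
          have "x * sqrt (real n) \<le> real (k n)" unfolding k_def by linarith
          then show ?case using elim by (simp add: le_divide_eq)
        qed
        show "\<forall>\<^sub>F n in sequentially. real (k n) / sqrt (real n) \<le> x + 1 / sqrt (real n)"
          using eventually_gt_at_top[of 0]
        proof eventually_elim
          case (elim n)
          have "0 \<le> x * sqrt (real n)" using False by simp
          then have "real (k n) \<le> x * sqrt (real n) + 1" unfolding k_def by linarith
          then show ?case using elim by (simp add: field_simps)
        qed
        show "(\<lambda>n. x + 1 / sqrt (real n)) \<longlonglongrightarrow> x" by real_asymp
      qed simp
      then have "(\<lambda>n. 1 - return_tail q n 0 (k n))
          \<longlonglongrightarrow> 1 - 2 * measure std_normal_distribution {..- (sqrt v * x)}"
        by (intro tendsto_diff tendsto_const tendsto_return_tail_zero_drift qv v)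
      moreover have "cdf (half_normal \<sigma>) x
          = 1 - 2 * measure std_normal_distribution {..- (sqrt v * x)}"
        using False by (subst cdf_half_normal[OF \<open>\<sigma> > 0\<close>]) (simp add: \<sigma> mult.commute)
      ultimately show ?thesis by (simp add: tendsto_cong)
    qed
    then show "weak_conv_m
        (\<lambda>n. distr (random_walk p n) borel (\<lambda>w. real (returns_to_zero w) / sqrt (real n)))
        (half_normal (sqrt (?P / deriv (deriv (jump_poly p)) 1)))"
      by (simp add: weak_conv_m_def weak_conv_def \<sigma>_def)
  }
qed

end
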